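(* Let $n\ge1$, let $s_1,\dots,s_n\in\{1,2\}$, and put $s=s_1+\cdots+s_n$. Let $p_s(x)$ be the polynomial satisfying $$\sum_{m\ge0}(m+1)^{s-n}(2m+1)^nx^m=\frac{p_s(x)}{(1-x)^{s+1}},$$ and let $(a,b)$ be its $\mathcal{I}_{s-1}$-decomposition. Then $\mathcal{I}_{s-1}(p_s)\ll p_s$. In particular, $p_s(x)$ is alternatingly increasing and $b\ll a$.
   Context: $p_s(x)$ is the descent polynomial over signed permutations $\pm\pi_1\pm\pi_2\cdots\pm\pi_s$ of the multiset $\{1^{s_1},\dots,n^{s_n}\}$ (with $\pi_0=0$). For a polynomial $p$ of degree at most $d$, $\mathcal{I}_d(p)(x)=x^dp(1/x)$, and the $\mathcal{I}_d$-decomposition of $p$ is the unique pair $(a,b)$ with $p=a+xb$, $\mathcal{I}_d(a)=a$ and $\mathcal{I}_{d-1}(b)=b$. For real-rooted real polynomials $f,g$ with zeros $\{r_i\}$, $\{s_j\}$ in decreasing order, $g\preceq f$ means either $\deg f=\deg g+1=d$ and $r_d\le s_{d-1}\le\cdots\le s_1\le r_1$, or $\deg f=\deg g=d$ and $s_d\le r_d\le\cdots\le s_1\le r_1$; $g\ll f$ means $g\preceq f$ with leading coefficients of the same sign, or $f\preceq g$ with leading coefficients of opposite sign. A polynomial $p=\sum_{j=0}^dp_jx^j$ of degree $d$ is alternatingly increasing if $0\le p_0\le p_d\le p_1\le p_{d-1}\le\cdots\le p_{\lfloor(d+1)/2\rfloor}$.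
   Formalization: The claims on I_{s-1}(p_s) and (a,b) are stated only when some s_i = 2; if all s_i = 1, p_s has degree s (n = 1: p_s = 1+x, s-1 = 0), so these are undefined. That p_s is alternatingly increasing is kept in all cases. *)

theory Defs
  imports Complex_Main "HOL-Computational_Algebra.Computational_Algebra"
begin

text \<open>
  The polynomial \<open>\<I>\<^sub>d(p)(x) = x\<^sup>d p(1/x)\<close>, meaningful when \<open>degree p \<le> d\<close> (see the lemma below).
  Note that \<^const>\<open>reflect_poly\<close> reflects with respect to \<open>degree p\<close>, not \<open>d\<close>.
\<close>
definition inv_poly :: "nat \<Rightarrow> real poly \<Rightarrow> real poly" where
  "inv_poly d p = monom 1 (d - degree p) * reflect_poly p"

lemma poly_inv_poly:
  assumes "degree p \<le> d" and "x \<noteq> 0"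
  shows "poly (inv_poly d p) x = x ^ d * poly p (1 / x)"
  using assms
  by (simp add: inv_poly_def poly_monom poly_reflect_poly_nz inverse_eq_divide
      flip: power_add mult.assoc)

text \<open>
  For \<open>d = 0\<close> the condition \<open>\<I>\<^sub>d\<^sub>-\<^sub>1(b) = b\<close> refers to polynomials of degree at most \<open>-1\<close> and
  so forces \<open>b = 0\<close>. For \<open>d > 0\<close> the disjunct \<open>b = 0\<close> is redundant.
\<close>
definition inv_decomposition :: "nat \<Rightarrow> real poly \<Rightarrow> real poly \<times> real poly \<Rightarrow> bool" where
  "inv_decomposition d p = (\<lambda>(a, b).
     degree p \<le> d \<and> p = a + [:0, 1:] * b \<and>
     degree a \<le> d \<and> inv_poly d a = a \<and>
     (b = 0 \<or> degree b < d \<and> inv_poly (d - 1) b = b))"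

text \<open>Zeros are counted with multiplicity; the zero polynomial is not real-rooted.\<close>
definition real_rooted :: "real poly \<Rightarrow> bool" where
  "real_rooted f \<longleftrightarrow> f \<noteq> 0 \<and> size (proots f) = degree f"

definition zeros_decreasing :: "real poly \<Rightarrow> real list" where
  "zeros_decreasing f = rev (sorted_list_of_multiset (proots f))"

text \<open>
  \<open>g \<preceq> f\<close>. The zeros \<open>r\<^sub>1 \<ge> r\<^sub>2 \<ge> \<dots>\<close> of \<open>f\<close> and \<open>s\<^sub>1 \<ge> s\<^sub>2 \<ge> \<dots>\<close> of \<open>g\<close> are lists indexed from
  0, so \<open>r ! i\<close> is \<open>r\<^sub>i\<^sub>+\<^sub>1\<close>.
\<close>
definition interlaces :: "real poly \<Rightarrow> real poly \<Rightarrow> bool" where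
  "interlaces g f \<longleftrightarrow> real_rooted g \<and> real_rooted f \<and>
     (let r = zeros_decreasing f; s = zeros_decreasing g in
       degree f = degree g + 1 \<and> (\<forall>i < degree g. s ! i \<le> r ! i \<and> r ! (i + 1) \<le> s ! i) \<or>
       degree f = degree g \<and> (\<forall>i < degree f. s ! i \<le> r ! i) \<and>
         (\<forall>i. i + 1 < degree f \<longrightarrow> r ! (i + 1) \<le> s ! i))"

definition poly_ll :: "real poly \<Rightarrow> real poly \<Rightarrow> bool" (infix \<open>\<lless>\<close> 50) where
  "g \<lless> f \<longleftrightarrow>
     interlaces g f \<and> sgn (lead_coeff g) = sgn (lead_coeff f) \<or>
     interlaces f g \<and> sgn (lead_coeff g) \<noteq> sgn (lead_coeff f)"

text \<open>
  The chain \<open>0 \<le> p\<^sub>0 \<le> p\<^sub>d \<le> p\<^sub>1 \<le> p\<^sub>d\<^sub>-\<^sub>1 \<le> \<dots>\<close> alternates between the links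
  \<open>p\<^sub>i \<le> p\<^sub>d\<^sub>-\<^sub>i\<close> and \<open>p\<^sub>d\<^sub>-\<^sub>i \<le> p\<^sub>i\<^sub>+\<^sub>1\<close>; it stops when all \<open>d + 1\<close> coefficients have been listed,
  that is, at the index \<open>\<lfloor>(d+1)/2\<rfloor>\<close>.
\<close>
definition alternatingly_increasing :: "real poly \<Rightarrow> bool" where
  "alternatingly_increasing p \<longleftrightarrow> (let d = degree p in
     0 \<le> coeff p 0 \<and>
     (\<forall>i. 2 * i < d \<longrightarrow> coeff p i \<le> coeff p (d - i)) \<and>
     (\<forall>i. 2 * i + 1 < d \<longrightarrow> coeff p (d - i) \<le> coeff p (i + 1)))"

end

theory Submission
  imports Defs
begin

text \<open>
  Write \<open>W(F)\<close> for \<open>(1 - x)\<^sup>S\<^sup>+\<^sup>1 \<Sum> F(m) x\<^sup>m\<close> and \<open>k = S - n > 0\<close>. The reflection \<open>q\<close> of \<open>p\<close> satisfies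
  \<open>x q = W(m\<^sup>k (2m+1)\<^sup>n)\<close>, while \<open>p = W((m+1)\<^sup>k (2m+1)\<^sup>n)\<close>. So both arise from the Eulerian
  polynomial (\<open>n = 0\<close>, where \<open>p = q\<close>) by applying one linear operator \<open>L\<close> per factor \<open>2m+1\<close>,
  and it suffices that \<open>L\<close> preserves \<open>p \<lless> g = x q\<close>. The sign of \<open>g'\<close> at the zeros of \<open>g\<close> gives
  the zeros of \<open>L g\<close>. At a zero \<open>w < 0\<close> of \<open>L g\<close> one has
  \<open>L p(w) g(w) = c w (1 - w) (p' g - p g')(w)\<close>, and by Lagrange interpolation at the zeros
  of \<open>g\<close> the Wronskian is minus a sum of squares, so \<open>L p\<close> alternates at the zeros of \<open>L g\<close>.

  From \<open>(1 - x) a = p - x q\<close> and \<open>q = a + b\<close>, \<open>a\<close> alternates at the zeros of \<open>x q\<close>, and \<open>b\<close> agrees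
  with \<open>q\<close> at the zeros of \<open>a\<close>. Both have only nonpositive zeros. Their coefficients are therefore log-concave and
  symmetric, hence unimodal, which is equivalent to \<open>p\<close> being alternatingly increasing.
\<close>


section \<open>Signs of products of linear factors, and zeros forced by alternating signs\<close>

lemma sgn_prod_diff:
  fixes x :: real
  assumes "finite I" "\<And>i. i \<in> I \<Longrightarrow> r i \<noteq> x"
  shows "0 < (-1) ^ card {i \<in> I. x < r i} * (\<Prod>i\<in>I. x - r i)"
  using assms
proof (induction I)
  case (insert i I)
  have *: "{j \<in> insert i I. x < r j} =
      (if x < r i then insert i {j \<in> I. x < r j} else {j \<in> I. x < r j})"
    by auto
  have IH: "0 < (-1) ^ card {j \<in> I. x < r j} * (\<Prod>j\<in>I. x - r j)"
    using insert by simp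
  show ?case
  proof (cases "x < r i")
    case True
    then have "0 < (r i - x) * ((-1) ^ card {j \<in> I. x < r j} * (\<Prod>j\<in>I. x - r j))"
      using IH by simp
    with True show ?thesis
      using insert.hyps unfolding * by (simp add: algebra_simps)
  next
    case False
    then have "0 < (x - r i) * ((-1) ^ card {j \<in> I. x < r j} * (\<Prod>j\<in>I. x - r j))"
      using IH insert.prems[of i] by (intro mult_pos_pos[OF _ IH]) auto
    with False show ?thesis
      using insert.hyps unfolding * by (simp add: algebra_simps)
  qed
qed simp

definition decreasing_upto :: "nat \<Rightarrow> (nat \<Rightarrow> real) \<Rightarrow> bool" where
  "decreasing_upto d r \<longleftrightarrow> (\<forall>i<d. r (Suc i) < r i)"

lemma decreasing_uptoD:
  assumes "decreasing_upto d r" "i < j" "j \<le> d"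
  shows "r j < r i"
  using assms(2,3)
proof (induction j)
  case (Suc j)
  then have "r (Suc j) < r j"
    using assms(1) by (simp add: decreasing_upto_def)
  then show ?case
    using Suc by (cases "i = j") auto
qed simp

lemma decreasing_upto_less_iff:
  assumes "decreasing_upto d r" "i \<le> d" "j \<le> d"
  shows "r j < r i \<longleftrightarrow> i < j"
  using decreasing_uptoD[OF assms(1)] assms(2,3)
  by (metis less_asym less_irrefl linorder_less_linear)

lemma decreasing_upto_eq_iff:
  assumes "decreasing_upto d r" "i \<le> d" "j \<le> d"
  shows "r j = r i \<longleftrightarrow> i = j"
  using decreasing_uptoD[OF assms(1)] assms(2,3)
  by (metis less_irrefl linorder_less_linear)

text \<open>Exactly \<open>r 0\<close>, ..., \<open>r j\<close> lie above \<open>x\<close>, each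
  giving one negative factor. For \<open>j = d\<close> the point lies below the whole sequence, so
  the lower bound is conditional.\<close>

lemma sgn_prod_decreasing:
  assumes "decreasing_upto d r" "j \<le> d" "x < r j" "j < d \<Longrightarrow> r (Suc j) < x"
  shows "0 < (-1) ^ Suc j * (\<Prod>i\<le>d. x - r i)"
proof -
  have lt: "x < r i" if "i \<le> j" for i
    using that assms decreasing_uptoD[OF assms(1), of i j] by (cases "i = j") auto
  have gt: "r i < x" if "j < i" "i \<le> d" for i
    using that assms decreasing_uptoD[OF assms(1), of "Suc j" i] by (cases "i = Suc j") auto
  have "{i \<in> {..d}. x < r i} = {..j}"
    using lt gt assms(2) by (auto simp: not_le) (metis gt less_asym not_le)
  moreover have "r i \<noteq> x" if "i \<in> {..d}" for i
    using lt[of i] gt[of i] that by (cases "i \<le> j") auto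
  ultimately show ?thesis
    using sgn_prod_diff[of "{..d}" r x] by simp
qed

text \<open>The product is the derivative of \<open>\<Prod>i\<le>d. x - r i\<close> at its zero
  \<open>r j\<close>, above which lie exactly \<open>j\<close> zeros.\<close>

lemma sgn_prod_decreasing_remove:
  assumes "decreasing_upto d r" "j \<le> d"
  shows "0 < (-1) ^ j * (\<Prod>i\<in>{..d} - {j}. r j - r i)"
proof -
  have "{i \<in> {..d} - {j}. r j < r i} = {..<j}"
    using assms by (auto simp: decreasing_upto_less_iff)
  moreover have "r i \<noteq> r j" if "i \<in> {..d} - {j}" for i
    using that assms by (simp add: decreasing_upto_eq_iff)
  ultimately show ?thesis
    using sgn_prod_diff[of "{..d} - {j}" r "r j"] by simp
qed

lemma degree_prod_linear [simp]:
  "degree (\<Prod>i\<in>I. [:- r i, 1 :: real:]) = card I"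
proof (cases "finite I")
  case True
  then show ?thesis by (subst degree_prod_eq_sum_degree) auto
qed simp

lemma coeff_card_prod_linear [simp]:
  "coeff (\<Prod>i\<in>I. [:- r i, 1 :: real:]) (card I) = 1"
  using lead_coeff_prod[of "\<lambda>i. [:- r i, 1 :: real:]" I] by simp

lemma poly_prod_linear [simp]:
  "poly (\<Prod>i\<in>I. [:- r i, 1 :: real:]) x = (\<Prod>i\<in>I. x - r i)"
  by (simp add: poly_prod)

text \<open>Degree below \<open>d\<close> is expressed by a bound and a vanishing coefficient, which
  also covers \<open>d = 0\<close>.\<close>

lemma poly_eq_0_many_roots:
  fixes f :: "real poly"
  assumes "degree f \<le> d" "coeff f d = 0" "inj_on r {..<d}" "\<And>i. i < d \<Longrightarrow> poly f (r i) = 0"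
  shows "f = 0"
proof (rule ccontr)
  assume f: "f \<noteq> 0"
  have "card (r ` {..<d}) \<le> card {x. poly f x = 0}"
    using assms(4) f by (intro card_mono) (auto simp: poly_roots_finite)
  then have "d \<le> degree f"
    using card_poly_roots_bound[OF f] card_image[OF assms(3)] by simp
  then have "degree f = d" using assms(1) by simp
  then show False using f assms(2) by auto
qed

text \<open>The intermediate value theorem puts a zero into each of the \<open>d\<close> gaps, and
  the degree leaves room for no others.\<close>

lemma roots_of_alternating:
  fixes f :: "real poly"
  assumes deg: "degree f \<le> d" and dec: "decreasing_upto d t"
    and alt: "\<And>i. i \<le> d \<Longrightarrow> 0 < (-1) ^ i * poly f (t i)"
  obtains r c where "c > 0" "f = smult c (\<Prod>i<d. [:- r i, 1:])"
    "\<And>i. i < d \<Longrightarrow> t (Suc i) < r i" "\<And>i. i < d \<Longrightarrow> r i < t i"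
proof -
  have "\<exists>x. t (Suc i) < x \<and> x < t i \<and> poly f x = 0" if "i < d" for i
  proof -
    have "t (Suc i) < t i" using that dec by (simp add: decreasing_upto_def)
    have "0 < ((-1) ^ i * poly f (t i)) * ((-1) ^ Suc i * poly f (t (Suc i)))"
      using that by (intro mult_pos_pos alt) auto
    also have "\<dots> = - (((-1) ^ i * (-1) ^ i) * (poly f (t (Suc i)) * poly f (t i)))"
      by simp
    also have "(-1) ^ i * (-1) ^ i = (1 :: real)"
      by (simp flip: power_mult_distrib)
    finally have "poly f (t (Suc i)) * poly f (t i) < 0" by simp
    from poly_IVT[OF \<open>t (Suc i) < t i\<close> this] show ?thesis by blast
  qed
  then obtain r where r: "\<And>i. i < d \<Longrightarrow> t (Suc i) < r i"
    "\<And>i. i < d \<Longrightarrow> r i < t i" "\<And>i. i < d \<Longrightarrow> poly f (r i) = 0"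
    by metis
  have r_dec: "r j < r i" if "i < j" "j < d" for i j
    using r(1)[of i] r(2)[of j] that decreasing_uptoD[OF dec, of "Suc i" j]
    by (cases "j = Suc i") auto
  have inj: "inj_on r {..<d}"
    using r_dec by (intro inj_onI) (metis lessThan_iff less_irrefl linorder_less_linear)
  define P where "P = (\<Prod>i<d. [:- r i, 1:])"
  have degP: "degree P = d" and lcP: "coeff P d = 1"
    using coeff_card_prod_linear[of r "{..<d}"] by (simp_all add: P_def)
  \<comment> \<open>Since \<open>P\<close> is monic of degree \<open>d\<close>, the difference has
    no term of degree \<open>d\<close>, yet it vanishes at all \<open>d\<close> points
    \<open>r i\<close>.\<close>
  have "f - smult (coeff f d) P = 0"
  proof (rule poly_eq_0_many_roots[OF _ _ inj])
    show "degree (f - smult (coeff f d) P) \<le> d"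
      using deg degP by (intro degree_diff_le) (auto intro: order.trans[OF degree_smult_le])
  next
    fix i assume "i < d"
    then show "poly (f - smult (coeff f d) P) (r i) = 0"
      using r(3) by (auto simp: P_def)
  qed (simp add: lcP)
  then have f: "f = smult (coeff f d) P" by simp
  \<comment> \<open>\<open>t 0\<close> lies above all zeros, so the sign of \<open>f\<close> there
    is the sign of \<open>coeff f d\<close>.\<close>
  have "0 < (\<Prod>i<d. t 0 - r i)"
    using r(2) decreasing_uptoD[OF dec, of 0]
    by (intro prod_pos) (metis diff_gt_0_iff_gt gr_zeroI lessThan_iff less_imp_le order.strict_trans)
  moreover have "0 < coeff f d * (\<Prod>i<d. t 0 - r i)"
    using alt[of 0] arg_cong[OF f, of "\<lambda>f. poly f (t 0)"] by (simp add: P_def)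
  ultimately have "coeff f d > 0" by (simp add: zero_less_mult_iff)
  with f r(1,2) show thesis by (intro that[of "coeff f d" r]) (auto simp: P_def)
qed

text \<open>Both sides have degree at most \<open>d\<close> and agree at the \<open>d + 1\<close>
  nodes.\<close>

lemma Lagrange_interpolation:
  fixes f :: "real poly"
  assumes "degree f \<le> d" "inj_on u {..d}"
  shows "f = (\<Sum>i\<le>d. smult (poly f (u i) / (\<Prod>j\<in>{..d} - {i}. u i - u j))
                        (\<Prod>j\<in>{..d} - {i}. [:- u j, 1:]))" (is "f = ?R")
proof -
  have "f - ?R = 0"
  proof (rule poly_eq_0_many_roots[of _ "Suc d"])
    show "degree (f - ?R) \<le> Suc d"
      using assms(1) by (intro degree_diff_le degree_sum_le)
        (auto intro!: order.trans[OF degree_smult_le])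
    have "degree (f - ?R) \<le> d"
      using assms(1) by (intro degree_diff_le degree_sum_le)
        (auto intro!: order.trans[OF degree_smult_le])
    then show "coeff (f - ?R) (Suc d) = 0" by (intro coeff_eq_0) simp
    show "inj_on u {..<Suc d}" using assms(2) by (simp add: lessThan_Suc_atMost)
  next
    fix k assume "k < Suc d"
    then have k: "k \<le> d" by simp
    have nz: "(\<Prod>j\<in>{..d} - {k}. u k - u j) \<noteq> 0"
      using assms(2) k by (auto simp: inj_on_def)
    have "poly ?R (u k) = (\<Sum>i\<le>d. poly f (u i) / (\<Prod>j\<in>{..d} - {i}. u i - u j) *
           (\<Prod>j\<in>{..d} - {i}. u k - u j))"
      by (simp add: poly_sum)
    also have "\<dots> = (\<Sum>i\<in>{k}. poly f (u i) / (\<Prod>j\<in>{..d} - {i}. u i - u j) *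
           (\<Prod>j\<in>{..d} - {i}. u k - u j))"
      using k by (intro sum.mono_neutral_right) auto
    also have "\<dots> = poly f (u k)" using nz by simp
    finally show "poly (f - ?R) (u k) = 0" by simp
  qed
  then show ?thesis by simp
qed


section \<open>Operators of Eulerian type and their effect on zeros\<close>

text \<open>
  If \<open>p = (1 - x)\<^sup>N \<Sum> F(m) x\<^sup>m\<close>, then \<open>eulerian_op e (c N - e) c p = (1 - x)\<^sup>N\<^sup>+\<^sup>1 \<Sum> (c m + e) F(m) x\<^sup>m\<close>.
\<close>
definition eulerian_op :: "real \<Rightarrow> real \<Rightarrow> real \<Rightarrow> real poly \<Rightarrow> real poly" where
  "eulerian_op A B c f = [:A, B:] * f + [:0, c, - c:] * pderiv f"

lemma coeff_eulerian_op_0 [simp]: "coeff (eulerian_op A B c f) 0 = A * coeff f 0"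
  by (simp add: eulerian_op_def)

text \<open>For \<open>A = c = 1\<close> and integer \<open>B\<close> this is the recurrence of the
  Eulerian numbers.\<close>

lemma coeff_eulerian_op_Suc [simp]:
  "coeff (eulerian_op A B c f) (Suc i) =
     (A + c * (real i + 1)) * coeff f (Suc i) + (B - c * real i) * coeff f i"
  by (cases i) (auto simp: eulerian_op_def coeff_pderiv algebra_simps)

lemma poly_eulerian_op:
  "poly (eulerian_op A B c f) x = (A + B * x) * poly f x + c * x * (1 - x) * poly (pderiv f) x"
  by (simp add: eulerian_op_def algebra_simps)

lemma degree_eulerian_op:
  assumes "degree f \<le> d"
  shows "degree (eulerian_op A B c f) \<le> Suc d"
proof (rule degree_le, intro allI impI)
  fix i assume "Suc d < i"
  then show "coeff (eulerian_op A B c f) i = 0"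
    using assms by (cases i) (auto simp: coeff_eq_0)
qed

lemma pderiv_linear_mult:
  "pderiv ([:- a, 1 :: real:] * h) = h + [:- a, 1:] * pderiv h"
  unfolding pderiv_mult by (simp add: pderiv_pCons)

lemma poly_pderiv_prod_linear_root:
  fixes u :: "nat \<Rightarrow> real"
  assumes "finite I" "i \<in> I"
  shows "poly (pderiv (\<Prod>j\<in>I. [:- u j, 1:])) (u i) = (\<Prod>j\<in>I - {i}. u i - u j)"
  unfolding prod.remove[OF assms, of "\<lambda>j. [:- u j, 1:]"] pderiv_linear_mult by simp

lemma sign_at_minus_infinity:
  fixes f :: "real poly"
  assumes "degree f = d" "coeff f d > 0"
  obtains M where "M < x" "0 < (-1) ^ d * poly f M"
proof -
  \<comment> \<open>\<open>g(x) = (-1)^d f(-x)\<close> has positive leading coefficient, hence is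
    positive far to the right.\<close>
  define g where "g = smult ((-1) ^ d) (pcompose f [:0, -1:])"
  have "lead_coeff g = ((-1) ^ d * (-1) ^ d) * lead_coeff f"
    using assms(1) by (simp add: g_def lead_coeff_comp)
  also have "(-1) ^ d * (-1) ^ d = (1 :: real)"
    by (simp flip: power_mult_distrib)
  finally have "lead_coeff g > 0" using assms by simp
  with poly_pinfty_gt_lc[OF this] obtain N where N: "\<And>y. y \<ge> N \<Longrightarrow> 0 < poly g y"
    by (meson less_le_trans)
  have "0 < poly g (max N (1 - x))" by (intro N) simp
  then show thesis
    by (intro that[of "- max N (1 - x)"]) (auto simp: g_def poly_pcompose)
qed

text \<open>
  The sequence \<open>u\<close> lists the zeros of \<open>x q\<close>, so \<open>u 0 = 0\<close> is not a zero of \<open>q\<close>.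
\<close>
definition simple_neg_zeros :: "nat \<Rightarrow> (nat \<Rightarrow> real) \<Rightarrow> real poly \<Rightarrow> bool" where
  "simple_neg_zeros d u q \<longleftrightarrow> u 0 = 0 \<and> decreasing_upto d u \<and>
     (\<exists>C>0. q = smult C (\<Prod>i<d. [:- u (Suc i), 1:]))"

lemma simple_neg_zeros_times_X:
  assumes "simple_neg_zeros d u q"
  obtains C where "C > 0" "[:0, 1:] * q = smult C (\<Prod>i\<le>d. [:- u i, 1:])"
  using assms unfolding simple_neg_zeros_def
  by (auto simp: prod.atMost_shift simp flip: prod.lessThan_Suc_shift)

lemma simple_neg_zeros_degree:
  assumes "simple_neg_zeros d u q"
  shows "degree q = d" "coeff q d > 0"
  using assms coeff_card_prod_linear[of "\<lambda>i. u (Suc i)" "{..<d}"]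
  by (auto simp: simple_neg_zeros_def)

text \<open>At a zero of \<open>x q\<close> the image of \<open>q\<close> is a positive multiple of
  the derivative of \<open>x q\<close>, whose signs alternate; a point far to the left supplies the
  last sign. The bound on \<open>B\<close> makes the new leading coefficient
  \<open>(B - c * d) * coeff q d\<close> positive.\<close>

lemma eulerian_op_zeros:
  assumes q: "simple_neg_zeros d u q" and pos: "A > 0" "c > 0" "B > c * real d"
  obtains w where "simple_neg_zeros (Suc d) w (eulerian_op A B c q)"
    "\<And>i. i \<le> d \<Longrightarrow> w (Suc i) < u i" "\<And>i. i < d \<Longrightarrow> u (Suc i) < w (Suc i)"
proof -
  define f where "f = eulerian_op A B c q"
  have u0: "u 0 = 0" and dec: "decreasing_upto d u"
    using q by (auto simp: simple_neg_zeros_def)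
  obtain C where C: "C > 0" and xq: "[:0, 1:] * q = smult C (\<Prod>i\<le>d. [:- u i, 1:])"
    using simple_neg_zeros_times_X[OF q] .
  note dq = simple_neg_zeros_degree[OF q]
  have degf: "degree f \<le> Suc d"
    unfolding f_def using dq(1) by (intro degree_eulerian_op) simp
  have lcf: "coeff f (Suc d) > 0"
    using dq pos by (simp add: f_def coeff_eq_0)
  have "degree f = Suc d"
    using degf lcf by (intro antisym le_degree) auto
  then obtain M where M: "M < u d" "0 < (-1) ^ Suc d * poly f M"
    using sign_at_minus_infinity lcf by blast
  define t where "t i = (if i \<le> d then u i else M)" for i
  have dect: "decreasing_upto (Suc d) t"
    using dec M(1) by (auto simp: decreasing_upto_def t_def less_Suc_eq Suc_le_eq)
  have alt: "0 < (-1) ^ i * poly f (t i)" if "i \<le> Suc d" for i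
  proof (cases "i = Suc d")
    case True
    then show ?thesis using M by (simp add: t_def)
  next
    case False
    with that have i: "i \<le> d" by simp
    have le0: "u i \<le> 0"
      using decreasing_uptoD[OF dec, of 0 i] u0 i by (cases "i = 0") auto
    define P where "P = (\<Prod>j\<in>{..d} - {i}. u i - u j)"
    have P: "0 < (-1) ^ i * P"
      unfolding P_def using dec i by (rule sgn_prod_decreasing_remove)
    have "poly (pderiv ([:0, 1:] * q)) (u i) = C * P"
      using i unfolding xq P_def
      by (simp add: pderiv_smult poly_pderiv_prod_linear_root)
    then have 1: "poly q (u i) + u i * poly (pderiv q) (u i) = C * P"
      by (simp add: pderiv_mult pderiv_pCons)
    have "poly ([:0, 1:] * q) (u i) = 0"
      using i unfolding xq by auto
    then have 2: "u i = 0 \<or> poly q (u i) = 0"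
      by simp
    \<comment> \<open>At \<open>0\<close> only the term \<open>A * q\<close> survives; at the other
      zeros \<open>q\<close> vanishes and the derivative term survives, with
      \<open>1 - u i > 0\<close>.\<close>
    have "\<exists>K>0. poly f (u i) = K * P"
    proof (cases "u i = 0")
      case True
      then show ?thesis
        using 1 C pos by (intro exI[of _ "A * C"]) (auto simp: f_def poly_eulerian_op)
    next
      case False
      have "poly f (u i) = c * (1 - u i) * (u i * poly (pderiv q) (u i))"
        using False 2 by (simp add: f_def poly_eulerian_op)
      also have "u i * poly (pderiv q) (u i) = C * P"
        using 1 2 False by simp
      finally show ?thesis
        using C pos le0 by (intro exI[of _ "c * (1 - u i) * C"]) auto
    qed
    then obtain K where "K > 0" "poly f (u i) = K * P" by blast
    with P have "0 < K * ((-1) ^ i * P)" by simp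
    with \<open>poly f (u i) = K * P\<close> i show ?thesis
      by (simp add: t_def algebra_simps)
  qed
  obtain r a where r: "a > 0" "f = smult a (\<Prod>i<Suc d. [:- r i, 1:])"
    "\<And>i. i < Suc d \<Longrightarrow> t (Suc i) < r i" "\<And>i. i < Suc d \<Longrightarrow> r i < t i"
    using roots_of_alternating[OF degf dect alt] by blast
  \<comment> \<open>\<open>0\<close> is put in front because \<open>simple_neg_zeros\<close> lists
    the zeros of \<open>x\<close> times the polynomial.\<close>
  define w where "w i = (case i of 0 \<Rightarrow> 0 | Suc j \<Rightarrow> r j)" for i
  have "r i < u i" if "i \<le> d" for i
    using that r(4)[of i] by (simp add: t_def)
  moreover have "u (Suc i) < r i" if "i < d" for i
    using that r(3)[of i] by (simp add: t_def)
  ultimately have "r 0 < u 0" "\<And>i. i < d \<Longrightarrow> r (Suc i) < r i"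
    by (blast, metis Suc_leI order.strict_trans)
  then have "w (Suc i) < w i" if "i < Suc d" for i
    using that u0 by (cases i) (auto simp: w_def)
  then have "decreasing_upto (Suc d) w"
    by (simp add: decreasing_upto_def)
  then have "simple_neg_zeros (Suc d) w f"
    using r(1,2) by (auto simp: simple_neg_zeros_def w_def)
  then show thesis
    using \<open>\<And>i. i \<le> d \<Longrightarrow> r i < u i\<close> \<open>\<And>i. i < d \<Longrightarrow> u (Suc i) < r i\<close>
    by (intro that[of w]) (auto simp: f_def w_def)
qed

text \<open>\<open>p\<close> is a nonnegative combination of the quotients \<open>h i\<close> of
  \<open>G\<close> by \<open>x - u i\<close>, and the Wronskian of \<open>h i\<close> with
  \<open>G\<close> is minus the square of \<open>h i\<close>. The signs are weak except at
  \<open>u 0\<close>, so \<open>p\<close> may vanish at the other nodes, as it does at the start of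
  the later induction.\<close>

lemma Wronskian_neg:
  fixes p :: "real poly"
  defines "G \<equiv> \<lambda>u d. \<Prod>i\<le>d. [:- u i, 1 :: real:]"
  assumes deg: "degree p \<le> d" and dec: "decreasing_upto d u"
    and p0: "poly p (u 0) > 0" and alt: "\<And>i. i \<le> d \<Longrightarrow> 0 \<le> (-1) ^ i * poly p (u i)"
    and x: "\<And>i. i \<le> d \<Longrightarrow> x \<noteq> u i"
  shows "poly (pderiv p) x * poly (G u d) x - poly p x * poly (pderiv (G u d)) x < 0"
proof -
  define h where "h i = (\<Prod>j\<in>{..d} - {i}. [:- u j, 1:])" for i
  define c where "c i = poly p (u i) / (\<Prod>j\<in>{..d} - {i}. u i - u j)" for i
  have inj: "inj_on u {..d}"
    using decreasing_upto_eq_iff[OF dec] by (auto simp: inj_on_def)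
  have p: "p = (\<Sum>i\<le>d. smult (c i) (h i))"
    unfolding c_def h_def by (rule Lagrange_interpolation[OF deg inj])
  \<comment> \<open>Expanding the fraction by \<open>(-1) ^ i\<close> gives, for
    \<open>i \<le> d\<close>, a nonnegative numerator and a positive denominator.\<close>
  have c_eq: "c i = ((-1) ^ i * poly p (u i)) / ((-1) ^ i * (\<Prod>j\<in>{..d} - {i}. u i - u j))" for i
    by (simp add: c_def)
  have c_nonneg: "0 \<le> c i" if "i \<le> d" for i
    unfolding c_eq using alt[OF that] sgn_prod_decreasing_remove[OF dec that]
    by (intro divide_nonneg_pos) auto
  have c0: "0 < c 0"
    unfolding c_eq using p0 sgn_prod_decreasing_remove[OF dec, of 0]
    by (intro divide_pos_pos) auto
  have W: "poly (pderiv (h i)) x * poly (G u d) x - poly (h i) x * poly (pderiv (G u d)) x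
      = - (poly (h i) x)\<^sup>2" if "i \<le> d" for i
  proof -
    have "G u d = [:- u i, 1:] * h i"
      unfolding G_def h_def using that by (intro prod.remove) auto
    then have "poly (pderiv (G u d)) x = poly (h i) x + (x - u i) * poly (pderiv (h i)) x"
      "poly (G u d) x = (x - u i) * poly (h i) x"
      by (simp_all only: pderiv_linear_mult) (simp_all add: algebra_simps)
    then show ?thesis
      unfolding power2_eq_square by algebra
  qed
  \<comment> \<open>Strictness comes from \<open>i = 0\<close>: \<open>c 0 > 0\<close>, and
    \<open>x\<close> is not a node.\<close>
  have pos: "0 < (\<Sum>i\<le>d. c i * (poly (h i) x)\<^sup>2)"
  proof (rule sum_pos2[of _ 0])
    show "0 < c 0 * (poly (h 0) x)\<^sup>2"
      using c0 x by (auto simp: h_def)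
  qed (use c_nonneg in auto)
  have "poly (pderiv p) x = (\<Sum>i\<le>d. c i * poly (pderiv (h i)) x)"
    "poly p x = (\<Sum>i\<le>d. c i * poly (h i) x)"
    by (simp_all add: p higher_pderiv_sum[of 1, simplified] pderiv_smult poly_sum)
  then have "poly (pderiv p) x * poly (G u d) x - poly p x * poly (pderiv (G u d)) x =
      (\<Sum>i\<le>d. c i * (poly (pderiv (h i)) x * poly (G u d) x - poly (h i) x * poly (pderiv (G u d)) x))"
    by (simp add: sum_distrib_right sum_subtractf right_diff_distrib mult.assoc)
  also have "\<dots> = - (\<Sum>i\<le>d. c i * (poly (h i) x)\<^sup>2)"
    using W by (simp add: sum_negf)
  also have "\<dots> < 0"
    using pos by simp
  finally show ?thesis .
qed

text \<open>Up to a factor \<open>x\<close>, the operator applied to \<open>q\<close> is the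
  operator applied to \<open>x q\<close>, so \<open>p\<close> and \<open>x q\<close> undergo the
  same operator. At a zero of the image of \<open>x q\<close> the first-order terms of
  \<open>p\<close> and \<open>x q\<close> combine into their Wronskian. Weak alternation thereby
  becomes strict.\<close>

lemma eulerian_op_interlacing:
  assumes q: "simple_neg_zeros d u q"
    and w: "simple_neg_zeros (Suc d) w (eulerian_op (e + c) (B - c) c q)"
      "\<And>i. i \<le> d \<Longrightarrow> w (Suc i) < u i" "\<And>i. i < d \<Longrightarrow> u (Suc i) < w (Suc i)"
    and p: "degree p \<le> d" "poly p 0 > 0" "\<And>i. i \<le> d \<Longrightarrow> 0 \<le> (-1) ^ i * poly p (u i)"
    and pos: "e > 0" "c > 0" and i: "i \<le> Suc d"
  shows "0 < (-1) ^ i * poly (eulerian_op e B c p) (w i)"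
proof (cases i)
  case 0
  \<comment> \<open>Here \<open>w 0 = 0\<close>, and the value is
    \<open>e * poly p 0\<close>.\<close>
  then show ?thesis
    using w(1) p(2) pos by (simp add: simple_neg_zeros_def poly_eulerian_op)
next
  case (Suc j)
  then have j: "j \<le> d" using i by simp
  define x where "x = w i"
  define G where "G = (\<Prod>i\<le>d. [:- u i, 1:])"
  have u0: "u 0 = 0" and dec: "decreasing_upto d u"
    using q by (auto simp: simple_neg_zeros_def)
  obtain C where C: "C > 0" and xq: "[:0, 1:] * q = smult C G"
    using simple_neg_zeros_times_X[OF q] unfolding G_def .
  have lt: "x < u j" using w(2)[OF j] by (simp add: x_def Suc)
  have gt: "u (Suc j) < x" if "j < d" using w(3)[OF that] by (simp add: x_def Suc)
  have "x < 0"
    using lt decreasing_uptoD[OF dec, of 0 j] j u0 by (cases "j = 0") auto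
  have sgnG: "0 < (-1) ^ i * poly G x"
    unfolding Suc using sgn_prod_decreasing[OF dec j lt gt] by (simp add: G_def)
  have ne: "x \<noteq> u k" if "k \<le> d" for k
  proof
    assume "x = u k"
    then have "poly G x = 0"
      using that by (auto simp: G_def)
    with sgnG show False by simp
  qed
  have "poly (pderiv p) x * poly G x - poly p x * poly (pderiv G) x < 0"
    unfolding G_def using p(2) u0 by (intro Wronskian_neg p dec ne) auto
  moreover have "c * x * (1 - x) < 0"
    using \<open>x < 0\<close> pos by (intro mult_neg_pos mult_pos_neg) auto
  ultimately have W: "0 < c * x * (1 - x) * (poly (pderiv p) x * poly G x - poly p x * poly (pderiv G) x)"
    by (rule mult_neg_neg[rotated])
  have root: "poly (eulerian_op (e + c) (B - c) c q) x = 0"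
    using w(1) j unfolding simple_neg_zeros_def
    by (auto simp: x_def Suc simp del: prod.lessThan_Suc intro!: bexI[of _ j])
  have "poly (pderiv ([:0, 1:] * q)) x = C * poly (pderiv G) x"
    unfolding xq by (simp add: pderiv_smult)
  then have G': "C * poly (pderiv G) x = poly q x + x * poly (pderiv q) x"
    by (simp add: pderiv_mult pderiv_pCons)
  have Gx: "C * poly G x = x * poly q x"
    using arg_cong[OF xq, of "\<lambda>f. poly f x"] by simp
  \<comment> \<open>\<open>eulerian_op e B c (x q) = x * eulerian_op (e + c) (B - c) c q\<close>\<close>
  have "C * ((e + B * x) * poly G x + c * x * (1 - x) * poly (pderiv G) x) =
      x * poly (eulerian_op (e + c) (B - c) c q) x"
    using G' Gx unfolding poly_eulerian_op by algebra
  then have "(e + B * x) * poly G x + c * x * (1 - x) * poly (pderiv G) x = 0"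
    using C root by simp
  \<comment> \<open>After multiplication by \<open>G\<close>, the equation just proved replaces
    \<open>(e + B * x) * G\<close> by a multiple of the derivative of \<open>G\<close>.\<close>
  then have "poly (eulerian_op e B c p) x * poly G x =
      c * x * (1 - x) * (poly (pderiv p) x * poly G x - poly p x * poly (pderiv G) x)"
    unfolding poly_eulerian_op by algebra
  then have "0 < poly (eulerian_op e B c p) x * poly G x" using W by simp
  then have "0 < ((-1) ^ i * (-1) ^ i) * (poly (eulerian_op e B c p) x * poly G x)"
    by (simp flip: power_mult_distrib)
  also have "\<dots> = ((-1) ^ i * poly (eulerian_op e B c p) x) * ((-1) ^ i * poly G x)"
    by (simp add: mult_ac)
  finally show ?thesis
    unfolding x_def[symmetric] by (rule zero_less_mult_pos2[OF _ sgnG])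
qed


section \<open>Interlacing of factored polynomials\<close>

lemma zeros_decreasing_prod_linear:
  assumes "c \<noteq> 0" and dec: "\<And>i j. i < j \<Longrightarrow> j < d \<Longrightarrow> r j < r i"
  shows "zeros_decreasing (smult c (\<Prod>i<d. [:- r i, 1:])) = map r [0..<d]"
    and "real_rooted (smult c (\<Prod>i<d. [:- r i, 1:]))"
proof -
  have "proots (smult c (\<Prod>i<d. [:- r i, 1:])) = (\<Sum>i<d. {#r i#})"
    using assms(1) by (simp add: proots_prod)
  also have "\<dots> = mset (map r [0..<d])"
    by (induction d) auto
  finally have *: "proots (smult c (\<Prod>i<d. [:- r i, 1:])) = mset (map r [0..<d])" .
  have "sorted (rev (map r [0..<d]))"
    using dec by (auto simp: sorted_rev_iff_nth_mono le_less)
  then have "sort (map r [0..<d]) = rev (map r [0..<d])"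
    by (intro properties_for_sort) auto
  then show "zeros_decreasing (smult c (\<Prod>i<d. [:- r i, 1:])) = map r [0..<d]"
    unfolding zeros_decreasing_def * sorted_list_of_multiset_mset by simp
  show "real_rooted (smult c (\<Prod>i<d. [:- r i, 1:]))"
    using assms(1) unfolding real_rooted_def * by auto
qed

text \<open>With positive leading coefficients the first disjunct of \<open>\<lless>\<close>
  applies. The case \<open>d = m\<close> serves a polynomial and its reflection,
  \<open>d = Suc m\<close> the pair \<open>b\<close>, \<open>a\<close>.\<close>

lemma poly_ll_prod_linear:
  assumes "a > 0" "b > 0" and m: "d = m \<or> d = Suc m"
    and le: "\<And>i. i < m \<Longrightarrow> s i \<le> r i" "\<And>i. Suc i < d \<Longrightarrow> r (Suc i) \<le> s i"
    and dec: "\<And>i j. i < j \<Longrightarrow> j < d \<Longrightarrow> r j < r i" "\<And>i j. i < j \<Longrightarrow> j < m \<Longrightarrow> s j < s i"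
  shows "smult a (\<Prod>i<m. [:- s i, 1:]) \<lless> smult b (\<Prod>i<d. [:- r i, 1:])"
proof -
  define f g where "f = smult b (\<Prod>i<d. [:- r i, 1:])" and "g = smult a (\<Prod>i<m. [:- s i, 1:])"
  have f: "zeros_decreasing f = map r [0..<d]" "real_rooted f" "degree f = d" "lead_coeff f = b"
    using assms zeros_decreasing_prod_linear[of b d r] coeff_card_prod_linear[of r "{..<d}"]
    by (auto simp: f_def simp del: prod.lessThan_Suc coeff_card_prod_linear)
  have g: "zeros_decreasing g = map s [0..<m]" "real_rooted g" "degree g = m" "lead_coeff g = a"
    using assms zeros_decreasing_prod_linear[of a m s] coeff_card_prod_linear[of s "{..<m}"]
    by (auto simp: g_def simp del: prod.lessThan_Suc coeff_card_prod_linear)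
  have "interlaces g f"
    using m le unfolding interlaces_def Let_def by (auto simp: f g simp del: upt_Suc)
  then show ?thesis
    using assms(1,2) f(4) g(4) by (simp add: poly_ll_def flip: f_def g_def)
qed

section \<open>Log-concavity and unimodality of coefficients\<close>

text \<open>The inequality is stated for all \<open>i \<le> j\<close>, not just neighbours: this
  form survives multiplication by \<open>x + t\<close> with \<open>t \<ge> 0\<close> even if
  coefficients vanish, and distant pairs are what symmetry calls for below.\<close>

lemma coeff_prod_linear_log_concave:
  fixes r :: "nat \<Rightarrow> real"
  assumes "\<And>i. i < d \<Longrightarrow> r i \<le> 0"
  defines "f \<equiv> \<Prod>i<d. [:- r i, 1:]"
  shows "0 \<le> coeff f i" and "i \<le> j \<Longrightarrow> coeff f i * coeff f (Suc j) \<le> coeff f (Suc i) * coeff f j"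
proof -
  have "(\<forall>i. 0 \<le> coeff f i) \<and>
      (\<forall>i j. i \<le> j \<longrightarrow> coeff f i * coeff f (Suc j) \<le> coeff f (Suc i) * coeff f j)"
    using assms(1) unfolding f_def
  proof (induction d)
    case (Suc d)
    define h where "h = coeff (\<Prod>i<d. [:- r i, 1:])"
    define g where "g = coeff (\<Prod>i<Suc d. [:- r i, 1:])"
    define t where "t = - r d"
    have t: "t \<ge> 0" using Suc.prems[of d] by (simp add: t_def)
    have h: "0 \<le> h i" for i
      using Suc by (simp add: h_def)
    have lc: "h i * h (Suc j) \<le> h (Suc i) * h j" if "i \<le> j" for i j
      using Suc that by (simp add: h_def)
    have g0: "g 0 = t * h 0" and gS: "g (Suc i) = h i + t * h (Suc i)" for i
      by (simp_all add: g_def h_def t_def algebra_simps)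
    have gnn: "0 \<le> g i" for i
      using h t by (cases i) (auto simp: g0 gS)
    have "g i * g (Suc j) \<le> g (Suc i) * g j" if "i \<le> j" for i j
    proof (cases "i = j")
      case False
      with that obtain k where k: "j = Suc k" "i \<le> k" by (cases j) auto
      have sq: "t * t * (h i * h (Suc j)) \<le> t * t * (h (Suc i) * h j)"
        using lc[OF that] t by (intro mult_left_mono) auto
      show ?thesis
      proof (cases i)
        case 0
        have "0 \<le> h 0 * h k" "0 \<le> t * (h (Suc 0) * h k)"
          using h t by auto
        with sq show ?thesis
          by (simp add: k 0 g0 gS algebra_simps)
      next
        case (Suc l)
        \<comment> \<open>Both sides expand into four products. \<open>t * h i * h j\<close> is
          common; the other three are compared singly, the one linear in \<open>t\<close> through
          \<open>h i * h j\<close>.\<close>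
        have "h l * h (Suc k) \<le> h i * h k"
          using lc[of l k] k Suc by simp
        moreover have "t * (h l * h (Suc j)) \<le> t * (h (Suc i) * h k)"
          using lc[of l j] lc[of i k] k Suc t by (intro mult_left_mono) auto
        ultimately show ?thesis
          using sq by (simp add: k Suc gS algebra_simps)
      qed
    qed simp
    with gnn show ?case unfolding g_def by blast
  qed (auto simp: not_le[symmetric])
  then show "0 \<le> coeff f i"
    and "i \<le> j \<Longrightarrow> coeff f i * coeff f (Suc j) \<le> coeff f (Suc i) * coeff f j"
    by auto
qed

text \<open>By symmetry, log-concavity for the pair \<open>i\<close>, \<open>d - 1 - i\<close>
  compares the squares of two nonnegative coefficients.\<close>

lemma coeff_palindromic_mono:
  assumes f: "f = smult c (\<Prod>i<d. [:- r i, 1 :: real:])" and "c \<ge> 0"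
    and "\<And>i. i < d \<Longrightarrow> r i \<le> 0"
    and pal: "\<And>i. i \<le> d \<Longrightarrow> coeff f i = coeff f (d - i)" and i: "2 * i + 1 \<le> d"
  shows "coeff f i \<le> coeff f (Suc i)"
proof -
  have nn: "0 \<le> coeff f k" for k
    using coeff_prod_linear_log_concave(1)[of d r k] assms(2,3) by (simp add: f)
  define j where "j = d - Suc i"
  have j: "i \<le> j" "Suc j = d - i" using i by (auto simp: j_def)
  have "c * c * (coeff (\<Prod>i<d. [:- r i, 1:]) i * coeff (\<Prod>i<d. [:- r i, 1:]) (Suc j)) \<le>
      c * c * (coeff (\<Prod>i<d. [:- r i, 1:]) (Suc i) * coeff (\<Prod>i<d. [:- r i, 1:]) j)"
    using assms(3) j(1) by (intro mult_left_mono coeff_prod_linear_log_concave) auto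
  then have "coeff f i * coeff f (Suc j) \<le> coeff f (Suc i) * coeff f j"
    by (simp add: f mult_ac)
  moreover have "coeff f (Suc j) = coeff f i" "coeff f j = coeff f (Suc i)"
    using pal[of i] pal[of "Suc i"] i j by (auto simp: j_def)
  ultimately have "(coeff f i)\<^sup>2 \<le> (coeff f (Suc i))\<^sup>2"
    by (simp add: power2_eq_square)
  then show ?thesis
    using nn by (rule power2_le_imp_le)
qed

section \<open>Reflection and the symmetric decomposition\<close>

lemma coeff_inv_poly:
  assumes "degree p \<le> d"
  shows "coeff (inv_poly d p) i = (if i \<le> d then coeff p (d - i) else 0)"
  using assms by (auto simp: inv_poly_def coeff_monom_mult coeff_reflect_poly coeff_eq_0)

text \<open>A relational form of \<open>inv_poly d p = q\<close> that carries both degree bounds and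
  is symmetric; \<open>reflects d p p\<close> means palindromic.\<close>

definition reflects :: "nat \<Rightarrow> real poly \<Rightarrow> real poly \<Rightarrow> bool" where
  "reflects d p q \<longleftrightarrow> degree p \<le> d \<and> degree q \<le> d \<and> (\<forall>i\<le>d. coeff q i = coeff p (d - i))"

lemma reflects_sym: "reflects d p q \<Longrightarrow> reflects d q p"
  by (auto simp: reflects_def)

lemma reflects_imp_inv_poly:
  assumes "reflects d p q"
  shows "inv_poly d p = q"
  using assms by (auto simp: reflects_def coeff_inv_poly coeff_eq_0 intro!: poly_eqI)

text \<open>Reversing the coefficients exchanges the two weights of the recurrence. The parameters
  are unchanged exactly when \<open>B = A + c * d\<close>, and then palindromes stay
  palindromes.\<close>

lemma reflects_eulerian_op:
  assumes "reflects d p q"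
  shows "reflects (Suc d) (eulerian_op A B c p) (eulerian_op (B - c * real d) (A + c * real d) c q)"
proof -
  have deg: "degree p \<le> d" "degree q \<le> d" and co: "\<And>i. i \<le> d \<Longrightarrow> coeff q i = coeff p (d - i)"
    using assms by (auto simp: reflects_def)
  have "coeff (eulerian_op (B - c * real d) (A + c * real d) c q) i =
      coeff (eulerian_op A B c p) (Suc d - i)" if "i \<le> Suc d" for i
  proof (cases i)
    case 0
    then show ?thesis using co[of 0] deg by (simp add: coeff_eq_0)
  next
    case (Suc k)
    show ?thesis
    proof (cases "k = d")
      case True
      then show ?thesis
        using co[of d] deg by (simp add: Suc coeff_eq_0)
    next
      case False
      with that Suc obtain l where l: "d = Suc (k + l)"
        by (metis Suc_le_mono le_neq_implies_less less_iff_Suc_add)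
      then show ?thesis
        using co[of k] co[of "Suc k"] by (simp add: Suc l algebra_simps)
    qed
  qed
  then show ?thesis
    using degree_eulerian_op[OF deg(1)] degree_eulerian_op[OF deg(2)]
    by (auto simp: reflects_def)
qed

text \<open>Reflection fixes \<open>a\<close> and sends \<open>x b\<close> to \<open>b\<close>.
  Conversely \<open>p - q = (x - 1) b\<close> changes sign under reflection, which forces
  \<open>b\<close>, and then \<open>a\<close>, to be symmetric.\<close>

lemma inv_decomposition_iff:
  assumes "reflects d p q" "d \<ge> 1"
  shows "inv_decomposition d p (a, b) \<longleftrightarrow> p = a + [:0, 1:] * b \<and> q = a + b \<and> degree b < d"
    (is "?L \<longleftrightarrow> ?R")
proof
  assume L: ?L
  then have p: "p = a + [:0, 1:] * b" and a: "degree a \<le> d" "inv_poly d a = a"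
    and b: "degree b < d" "inv_poly (d - 1) b = b"
    using assms by (auto simp: inv_decomposition_def inv_poly_def)
  have "coeff q i = coeff (a + b) i" for i
  proof (cases "i < d")
    case True
    then obtain k where k: "d - i = Suc k" "k = d - 1 - i" by (cases "d - i") auto
    have "coeff q i = coeff p (d - i)" using assms True by (simp add: reflects_def)
    also have "\<dots> = coeff a (d - i) + coeff b (d - 1 - i)" using k by (simp add: p)
    also have "coeff a (d - i) = coeff a i"
      using coeff_inv_poly[OF a(1), of i] a(2) True by simp
    also have "coeff b (d - 1 - i) = coeff b i"
      using coeff_inv_poly[of b "d - 1" i] b True by simp
    finally show ?thesis by simp
  next
    case False
    \<comment> \<open>For \<open>i = d\<close> the index \<open>d - 1 - i\<close> would be
      truncated; instead \<open>coeff p 0 = coeff a 0 = coeff a d\<close>.\<close>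
    have "coeff q d = coeff a d"
      using assms coeff_inv_poly[OF a(1), of d] a(2) by (simp add: reflects_def p)
    with False show ?thesis
      using assms a(1) b(1) by (cases "i = d") (auto simp: reflects_def coeff_eq_0)
  qed
  then show ?R using p b(1) by (auto intro: poly_eqI)
next
  assume R: ?R
  then have p: "p = a + [:0, 1:] * b" and q: "q = a + b" and degb: "degree b < d"
    by auto
  have degp: "degree p \<le> d" and degq: "degree q \<le> d"
    using assms by (auto simp: reflects_def)
  have "degree (q - b) \<le> d"
    using degq degb by (intro degree_diff_le) auto
  then have dega: "degree a \<le> d" by (simp add: q)
  \<comment> \<open>The factors \<open>x\<close> and \<open>x - 1\<close> make the equation hold at
    every real point; they are cancelled afterwards in the polynomial ring.\<close>
  have "poly ([:0, 1:] * ([:-1, 1:] * inv_poly (d - 1) b)) x =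
      poly ([:0, 1:] * ([:-1, 1:] * b)) x" for x
  proof (cases "x = 0")
    case False
    have "poly q x = x ^ d * poly p (1 / x)" "poly p x = x ^ d * poly q (1 / x)"
      using poly_inv_poly[OF degp False] poly_inv_poly[OF degq False]
        reflects_imp_inv_poly[OF assms(1)] reflects_imp_inv_poly[OF reflects_sym[OF assms(1)]]
      by auto
    then have "poly p x - poly q x = x ^ d * ((1 - 1 / x) * poly b (1 / x))"
      by (simp add: p q algebra_simps)
    also have "\<dots> = (x - 1) * (x ^ (d - 1) * poly b (1 / x))"
      using False \<open>d \<ge> 1\<close> by (cases d) (auto simp: field_simps)
    also have "x ^ (d - 1) * poly b (1 / x) = poly (inv_poly (d - 1) b) x"
      using degb False by (intro poly_inv_poly[symmetric]) auto
    finally have *: "(x - 1) * poly (inv_poly (d - 1) b) x = (x - 1) * poly b x"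
      by (simp add: p q algebra_simps)
    have "poly ([:0, 1:] * ([:-1, 1:] * h)) x = x * ((x - 1) * poly h x)" for h
      by (simp add: algebra_simps)
    then show ?thesis by (simp only: *)
  qed simp
  then have "[:0, 1:] * ([:-1, 1:] * inv_poly (d - 1) b) = [:0, 1:] * ([:-1, 1:] * b)"
    by (intro poly_eq_poly_eq_iff[THEN iffD1] ext)
  then have b: "inv_poly (d - 1) b = b"
    by (simp only: mult_cancel_left) simp
  have "inv_poly d a = a"
  proof (rule poly_eqI)
    fix i
    show "coeff (inv_poly d a) i = coeff a i"
    proof (cases "i < d")
      case True
      then obtain k where k: "d - i = Suc k" "k = d - 1 - i" by (cases "d - i") auto
      have "coeff q i = coeff p (d - i)" using assms True by (simp add: reflects_def)
      also have "\<dots> = coeff a (d - i) + coeff b (d - 1 - i)" using k by (simp add: p)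
      also have "coeff b (d - 1 - i) = coeff b i"
        using coeff_inv_poly[of b "d - 1" i] b degb True by simp
      finally show ?thesis
        using True dega by (simp add: q coeff_inv_poly)
    next
      case False
      have "coeff q d = coeff p 0" using assms by (simp add: reflects_def)
      then show ?thesis
        using False degb dega by (auto simp: p q coeff_inv_poly coeff_eq_0)
    qed
  qed
  with b p degp dega degb show ?L
    by (simp add: inv_decomposition_def)
qed

text \<open>\<open>p\<close> and \<open>q\<close> agree at \<open>1\<close>, so \<open>b\<close> is
  the quotient of \<open>p - q\<close> by \<open>x - 1\<close>, and
  \<open>a = q - b\<close>.\<close>

lemma inv_decomposition_unique_exists:
  assumes "reflects d p q" "d \<ge> 1"
  shows "\<exists>!ab. inv_decomposition d p ab"
proof -
  have deg: "degree p \<le> d" "degree q \<le> d"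
    using assms by (auto simp: reflects_def)
  have "poly p 1 = poly q 1"
    using poly_inv_poly[OF deg(1), of 1] reflects_imp_inv_poly[OF assms(1)] by simp
  then have "[:-1, 1:] dvd p - q"
    by (simp flip: poly_eq_0_iff_dvd)
  then obtain b where b: "p - q = [:-1, 1:] * b" by (elim dvdE)
  have "degree b < d"
  proof (cases "b = 0")
    case False
    then have "degree ([:-1, 1:] * b) = Suc (degree b)"
      by (subst degree_mult_eq) auto
    moreover have "degree (p - q) \<le> d" using deg by (rule degree_diff_le)
    ultimately show ?thesis using b by simp
  qed (use assms in simp)
  then have "inv_decomposition d p (q - b, b)"
    using b by (simp add: inv_decomposition_iff[OF assms] algebra_simps)
  moreover have "ab = ab'" if "inv_decomposition d p ab" "inv_decomposition d p ab'" for ab ab'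
  proof -
    obtain x y x' y' where xy: "ab = (x, y)" "ab' = (x', y')" by (cases ab, cases ab')
    then have "p = x + [:0, 1:] * y" "q = x + y" "p = x' + [:0, 1:] * y'" "q = x' + y'"
      using that unfolding xy inv_decomposition_iff[OF assms] by blast+
    then have "[:-1, 1:] * y = [:-1, 1:] * y'" and "x = q - y" "x' = q - y'"
      by (simp_all add: algebra_simps)
    then show ?thesis
      using xy by (simp only: mult_cancel_left) simp
  qed
  ultimately show ?thesis by blast
qed


text \<open>The two kinds of links are differences of neighbours:
  \<open>p_(d-i) - p_i = b_i - b_(i-1)\<close> and
  \<open>p_(i+1) - p_(d-i) = a_(i+1) - a_i\<close>.\<close>

lemma alternatingly_increasing_of_decomposition:
  assumes p: "degree p = d" "p = a + [:0, 1:] * b" and refl: "reflects d p (a + b)"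
    and p0: "0 \<le> coeff p 0" and b0: "0 \<le> coeff b 0"
    and a: "\<And>i. 2 * i + 1 \<le> d \<Longrightarrow> coeff a i \<le> coeff a (Suc i)"
    and b: "\<And>i. 2 * i + 2 \<le> d \<Longrightarrow> coeff b i \<le> coeff b (Suc i)"
  shows "alternatingly_increasing p"
proof -
  have r: "coeff p (d - i) = coeff a i + coeff b i" if "i \<le> d" for i
    using refl that by (simp add: reflects_def)
  have "coeff p i \<le> coeff p (d - i)" if "2 * i < d" for i
    using that r[of i] b0 b[of "i - 1"] by (cases i) (auto simp: p(2))
  moreover have "coeff p (d - i) \<le> coeff p (i + 1)" if "2 * i + 1 < d" for i
    using that r[of i] a[of i] by (simp add: p(2))
  ultimately show ?thesis
    using p0 by (auto simp: alternatingly_increasing_def Let_def p(1))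
qed

lemma interlacing_symmetric_decomposition:
  assumes q: "simple_neg_zeros d u q" and refl: "reflects d p q" and d: "d \<ge> 1"
    and alt: "\<And>i. i \<le> d \<Longrightarrow> 0 < (-1) ^ i * poly p (u i)"
  shows "inv_poly d p \<lless> p" and "alternatingly_increasing p"
    and "inv_decomposition d p (a, b) \<Longrightarrow> b \<lless> a"
proof -
  have u0: "u 0 = 0" and dec: "decreasing_upto d u"
    using q by (auto simp: simple_neg_zeros_def)
  obtain C where C: "C > 0" "q = smult C (\<Prod>i<d. [:- u (Suc i), 1:])"
    using q by (auto simp: simple_neg_zeros_def)
  have xq: "[:0, 1:] * q = smult C (\<Prod>i\<le>d. [:- u i, 1:])"
    using u0 C by (auto simp: prod.atMost_shift simp flip: prod.lessThan_Suc_shift)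
  have degp: "degree p \<le> d" using refl by (simp add: reflects_def)
  have u_neg: "u i \<le> 0" if "i \<le> d" for i
    using decreasing_uptoD[OF dec, of 0 i] u0 that by (cases "i = 0") auto
  \<comment> \<open>Points chosen one from each gap of a decreasing sequence are decreasing
    themselves.\<close>
  have between: "t j < t i"
    if "i < j" "j < m" "m \<le> d'" "decreasing_upto d' v"
      "\<And>k. k < m \<Longrightarrow> v (Suc k) < t k" "\<And>k. k < m \<Longrightarrow> t k < v k" for t v :: "nat \<Rightarrow> real" and i j m d'
  proof -
    have "t j < v j" using that(2) by (rule that(6))
    also have "v j \<le> v (Suc i)"
      using that(1-3) decreasing_uptoD[OF that(4), of "Suc i" j] by (cases "j = Suc i") auto
    also have "v (Suc i) < t i" using that(1,2) by (intro that(5)) simp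
    finally show ?thesis .
  qed
  obtain r cp where cp: "cp > 0" and p: "p = smult cp (\<Prod>i<d. [:- r i, 1:])"
    and r: "\<And>i. i < d \<Longrightarrow> u (Suc i) < r i" "\<And>i. i < d \<Longrightarrow> r i < u i"
    using roots_of_alternating[OF degp dec alt] by blast
  have r_dec: "r j < r i" if "i < j" "j < d" for i j
    using between[OF that order.refl dec] r by blast
  have "q \<lless> p"
    unfolding p C(2)
  proof (intro poly_ll_prod_linear)
    show "u (Suc j) < u (Suc i)" if "i < j" "j < d" for i j
      using decreasing_uptoD[OF dec, of "Suc i" "Suc j"] that by simp
  qed (use C cp r r_dec in \<open>auto intro: less_imp_le\<close>)
  then show "inv_poly d p \<lless> p"
    using reflects_imp_inv_poly[OF refl] by simp
  \<comment> \<open>Stated for an arbitrary pair: the claim about \<open>p\<close> alone applies it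
    to the decomposition whose existence is already known.\<close>
  have decomp: "b \<lless> a \<and> alternatingly_increasing p" if L: "inv_decomposition d p (a, b)" for a b
  proof -
    have pab: "p = a + [:0, 1:] * b" and qab: "q = a + b" and degb: "degree b < d"
      using L by (auto simp: inv_decomposition_iff[OF refl d])
    have dega: "degree a \<le> d"
      using L by (auto simp: inv_decomposition_def)
    have alt_a: "0 < (-1) ^ i * poly a (u i)" if i: "i \<le> d" for i
    proof -
      have "u i * poly q (u i) = 0"
        using arg_cong[OF xq, of "\<lambda>f. poly f (u i)"] i by auto
      then have *: "poly p (u i) = (1 - u i) * poly a (u i)"
        unfolding pab qab by (simp add: algebra_simps)
      have "0 < (1 - u i) * ((-1) ^ i * poly a (u i))"
        using alt[OF i] unfolding * by (simp add: mult_ac)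
      then show ?thesis
        by (rule zero_less_mult_pos) (use u_neg[OF i] in simp)
    qed
    obtain \<alpha> ca where ca: "ca > 0" and a: "a = smult ca (\<Prod>i<d. [:- \<alpha> i, 1:])"
      and \<alpha>: "\<And>i. i < d \<Longrightarrow> u (Suc i) < \<alpha> i" "\<And>i. i < d \<Longrightarrow> \<alpha> i < u i"
      using roots_of_alternating[OF dega dec alt_a] by blast
    have \<alpha>_dec: "\<alpha> j < \<alpha> i" if "i < j" "j < d" for i j
      using between[OF that order.refl dec] \<alpha> by blast
    then have dec\<alpha>: "decreasing_upto (d - 1) \<alpha>"
      by (auto simp: decreasing_upto_def)
    have alt_b: "0 < (-1) ^ i * poly b (\<alpha> i)" if i: "i \<le> d - 1" for i
    proof -
      have i': "i < d" using i d by simp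
      have "poly a (\<alpha> i) = 0"
        unfolding a using i' by auto
      then have *: "poly b (\<alpha> i) = poly q (\<alpha> i)"
        by (simp add: qab)
      \<comment> \<open>Exactly \<open>i + 1\<close> zeros of \<open>x q\<close> lie above
        \<open>\<alpha> i\<close>; dividing by the negative factor \<open>\<alpha> i\<close> removes
        one sign.\<close>
      have "0 < (-1) ^ Suc i * (\<Prod>k\<le>d. \<alpha> i - u k)"
        using sgn_prod_decreasing[OF dec, of i "\<alpha> i"] i' \<alpha>[OF i'] by simp
      then have "0 < C * ((-1) ^ Suc i * (\<Prod>k\<le>d. \<alpha> i - u k))"
        by (rule mult_pos_pos[OF C(1)])
      also have "\<dots> = (-1) ^ Suc i * poly ([:0, 1:] * q) (\<alpha> i)"
        unfolding xq by (simp add: mult_ac)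
      also have "\<dots> = - \<alpha> i * ((-1) ^ i * poly q (\<alpha> i))"
        by simp
      finally show ?thesis
        unfolding * by (rule zero_less_mult_pos) (use \<alpha>(2)[OF i'] u_neg[of i] i' in simp)
    qed
    have "degree b \<le> d - 1" using degb by simp
    then obtain \<beta> cb where cb: "cb > 0" and b: "b = smult cb (\<Prod>i<d - 1. [:- \<beta> i, 1:])"
      and \<beta>: "\<And>i. i < d - 1 \<Longrightarrow> \<alpha> (Suc i) < \<beta> i" "\<And>i. i < d - 1 \<Longrightarrow> \<beta> i < \<alpha> i"
      using roots_of_alternating[OF _ dec\<alpha> alt_b] by blast
    have \<beta>_dec: "\<beta> j < \<beta> i" if "i < j" "j < d - 1" for i j
      using between[OF that order.refl dec\<alpha>] \<beta> by blast
    have "b \<lless> a"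
      unfolding a b using d ca cb \<beta> \<alpha>_dec \<beta>_dec
      by (intro poly_ll_prod_linear) (auto intro: less_imp_le)
    have \<alpha>_neg: "\<alpha> i \<le> 0" if "i < d" for i
      using \<alpha>(2)[OF that] u_neg[of i] that by simp
    have \<beta>_neg: "\<beta> i \<le> 0" if "i < d - 1" for i
      using \<beta>(2)[OF that] \<alpha>_neg[of i] that by linarith
    have "alternatingly_increasing p"
    proof (rule alternatingly_increasing_of_decomposition)
      show "degree p = d" using cp by (simp add: p)
      show "p = a + [:0, 1:] * b" by (fact pab)
      show "reflects d p (a + b)" using refl qab by simp
      show "0 \<le> coeff p 0"
        using alt[of 0] u0 by (simp add: poly_0_coeff_0)
      show "0 \<le> coeff b 0"
        using coeff_prod_linear_log_concave(1)[of "d - 1" \<beta> 0] \<beta>_neg cb by (simp add: b)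
      show "coeff a i \<le> coeff a (Suc i)" if "2 * i + 1 \<le> d" for i
      proof (rule coeff_palindromic_mono[OF a _ \<alpha>_neg _ that])
        show "coeff a i = coeff a (d - i)" if "i \<le> d" for i
          using coeff_inv_poly[OF dega, of i] L that by (simp add: inv_decomposition_def)
      qed (use ca in auto)
      show "coeff b i \<le> coeff b (Suc i)" if "2 * i + 2 \<le> d" for i
      proof (rule coeff_palindromic_mono[OF b _ \<beta>_neg])
        show "coeff b i = coeff b (d - 1 - i)" if "i \<le> d - 1" for i
          using coeff_inv_poly[of b "d - 1" i] L that by (auto simp: inv_decomposition_def)
      qed (use cb that in auto)
    qed
    with \<open>b \<lless> a\<close> show ?thesis by simp
  qed
  then show "inv_decomposition d p (a, b) \<Longrightarrow> b \<lless> a" by blast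
  show "alternatingly_increasing p"
    using inv_decomposition_unique_exists[OF refl d] decomp by auto
qed

section \<open>Generating functions of three families of polynomials\<close>

text \<open>Multiplying the coefficients by \<open>c m + e\<close> is the operator
  \<open>e + c x d/dx\<close> on the series; the product rule carries it past the power of
  \<open>1 - x\<close>.\<close>

lemma fps_eulerian_op:
  fixes f :: "nat \<Rightarrow> real"
  assumes "fps_of_poly p = Abs_fps f * (1 - fps_X) ^ Suc N"
  shows "fps_of_poly (eulerian_op e (c * real (Suc N) - e) c p) =
    Abs_fps (\<lambda>m. (c * real m + e) * f m) * (1 - fps_X) ^ Suc (Suc N)"
proof -
  define F E K M Y Z where "F = Abs_fps f" and "E = fps_const e" and "K = fps_const c"
    and "M = fps_const (real (Suc N))" and "Y = (1 - fps_X :: real fps)" and "Z = Y ^ N"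
  have P: "fps_of_poly p = F * (Y * Z)"
    using assms by (simp add: F_def Y_def Z_def)
  have YZ: "fps_deriv (Y * Z) = - M * Z"
    unfolding Z_def power_Suc[symmetric] fps_deriv_power by (simp add: M_def Y_def mult_ac)
  then have P': "fps_of_poly (pderiv p) = fps_deriv F * (Y * Z) - M * F * Z"
    unfolding fps_of_poly_pderiv P fps_deriv_mult[of F] YZ by (simp add: algebra_simps)
  have "fps_const (c * real (Suc N) - e) = K * M - E"
    unfolding K_def M_def E_def by (simp only: fps_const_mult fps_const_sub)
  then have "fps_of_poly [:e, c * real (Suc N) - e:] = E + (K * M - E) * fps_X"
    by (simp only: fps_of_poly_pCons E_def) simp
  moreover have "fps_of_poly [:0, c, - c:] = K * fps_X * Y"
    by (simp add: fps_of_poly_pCons K_def Y_def algebra_simps flip: fps_const_neg)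
  ultimately have "fps_of_poly (eulerian_op e (c * real (Suc N) - e) c p) =
      (E + (K * M - E) * fps_X) * (F * (Y * Z)) +
      K * fps_X * Y * (fps_deriv F * (Y * Z) - M * F * Z)"
    unfolding eulerian_op_def fps_of_poly_add fps_of_poly_mult P P' by (simp only:)
  also have "\<dots> = (E * F + K * fps_X * fps_deriv F) * (Y * (Y * Z))"
    unfolding Y_def by (simp add: algebra_simps)
  also have "E * F + K * fps_X * fps_deriv F = Abs_fps (\<lambda>m. (c * real m + e) * f m)"
  proof (rule fps_ext)
    fix m
    show "(E * F + K * fps_X * fps_deriv F) $ m = Abs_fps (\<lambda>m. (c * real m + e) * f m) $ m"
      by (cases m) (simp_all add: E_def K_def F_def mult.assoc algebra_simps)
  qed
  finally show ?thesis by (simp add: Y_def Z_def)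
qed

lemma fps_geometric_series: "Abs_fps (\<lambda>m. 1) * (1 - fps_X) ^ Suc 0 = (1 :: real fps)"
proof (rule fps_ext)
  fix n
  show "(Abs_fps (\<lambda>m. 1) * (1 - fps_X) ^ Suc 0) $ n = (1 :: real fps) $ n"
    by (cases n) (simp_all add: right_diff_distrib)
qed

lemma Eulerian_polynomial:
  obtains p u where "simple_neg_zeros k u p" "reflects k p p" "coeff p 0 = 1"
    "fps_of_poly p = Abs_fps (\<lambda>m. (real m + 1) ^ Suc k) * (1 - fps_X) ^ (k + 2)"
proof -
  have "\<exists>p u. simple_neg_zeros k u p \<and> reflects k p p \<and> coeff p 0 = 1 \<and>
    fps_of_poly p = Abs_fps (\<lambda>m. (real m + 1) ^ Suc k) * (1 - fps_X) ^ (k + 2)"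
  proof (induction k)
    case 0
    \<comment> \<open>The first application has \<open>B = 0\<close> and leaves \<open>1\<close>
      unchanged, which is why the degree \<open>k\<close> stays one below the exponent.\<close>
    have "fps_of_poly (1 :: real poly) = Abs_fps (\<lambda>m. 1) * (1 - fps_X) ^ Suc 0"
      by (simp only: fps_geometric_series fps_of_poly_1)
    from fps_eulerian_op[OF this, of 1 1]
    have "fps_of_poly (eulerian_op 1 0 1 1) =
        Abs_fps (\<lambda>m. (real m + 1) ^ Suc 0) * (1 - fps_X) ^ (0 + 2)"
      by (simp add: numeral_2_eq_2)
    moreover have "eulerian_op 1 0 1 1 = 1"
      by (simp add: eulerian_op_def)
    ultimately show ?case
      by (intro exI[of _ 1] exI[of _ "\<lambda>_. 0"])
        (auto simp: simple_neg_zeros_def decreasing_upto_def reflects_def intro!: exI[of _ 1])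
  next
    case (Suc k)
    then obtain p u where p: "simple_neg_zeros k u p" "reflects k p p" "coeff p 0 = 1"
      "fps_of_poly p = Abs_fps (\<lambda>m. (real m + 1) ^ Suc k) * (1 - fps_X) ^ Suc (k + 1)"
      by auto
    obtain w where "simple_neg_zeros (Suc k) w (eulerian_op 1 (real k + 1) 1 p)"
      by (rule eulerian_op_zeros[OF p(1), of 1 1 "real k + 1"]) (simp, simp, simp, blast)
    moreover have "reflects (Suc k) (eulerian_op 1 (real k + 1) 1 p) (eulerian_op 1 (real k + 1) 1 p)"
      using reflects_eulerian_op[OF p(2), of 1 "real k + 1" 1] by (simp add: add.commute)
    moreover have "fps_of_poly (eulerian_op 1 (real k + 1) 1 p) =
        Abs_fps (\<lambda>m. (real m + 1) ^ Suc (Suc k)) * (1 - fps_X) ^ (Suc k + 2)"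
      using fps_eulerian_op[OF p(4), of 1 1] by (simp add: add.commute)
    ultimately show ?case
      using p(3) by (intro exI[of _ "eulerian_op 1 (real k + 1) 1 p"] exI[of _ w]) simp
  qed
  then show thesis using that by blast
qed

text \<open>This is the case \<open>S = n\<close>. Here \<open>A = 1\<close>, \<open>c = 2\<close>
  and \<open>B = 2 * n + 1 = A + c * n\<close>, so symmetry persists.\<close>

lemma type_B_Eulerian_polynomial:
  obtains p u where "simple_neg_zeros n u p" "reflects n p p"
    "fps_of_poly p = Abs_fps (\<lambda>m. (2 * real m + 1) ^ n) * (1 - fps_X) ^ Suc n"
proof -
  have "\<exists>p u. simple_neg_zeros n u p \<and> reflects n p p \<and>
    fps_of_poly p = Abs_fps (\<lambda>m. (2 * real m + 1) ^ n) * (1 - fps_X) ^ Suc n"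
  proof (induction n)
    case 0
    show ?case
      unfolding power_0 fps_geometric_series
      by (intro exI[of _ 1] exI[of _ "\<lambda>_. 0"])
        (auto simp: simple_neg_zeros_def decreasing_upto_def reflects_def intro!: exI[of _ 1])
  next
    case (Suc n)
    then obtain p u where p: "simple_neg_zeros n u p" "reflects n p p"
      "fps_of_poly p = Abs_fps (\<lambda>m. (2 * real m + 1) ^ n) * (1 - fps_X) ^ Suc n"
      by auto
    obtain w where "simple_neg_zeros (Suc n) w (eulerian_op 1 (2 * real n + 1) 2 p)"
      by (rule eulerian_op_zeros[OF p(1), of 1 2 "2 * real n + 1"]) (simp, simp, simp, blast)
    moreover have "reflects (Suc n) (eulerian_op 1 (2 * real n + 1) 2 p) (eulerian_op 1 (2 * real n + 1) 2 p)"
      using reflects_eulerian_op[OF p(2), of 1 "2 * real n + 1" 2] by (simp add: add.commute)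
    moreover have "fps_of_poly (eulerian_op 1 (2 * real n + 1) 2 p) =
        Abs_fps (\<lambda>m. (2 * real m + 1) ^ Suc n) * (1 - fps_X) ^ Suc (Suc n)"
      using fps_eulerian_op[OF p(3), of 1 2] by (simp add: algebra_simps)
    ultimately show ?case by blast
  qed
  then show thesis using that by blast
qed

text \<open>The induction on \<open>n\<close> starts at \<open>p = q\<close>, where alternation is
  only weak; the first factor \<open>2 m + 1\<close> makes it strict, hence
  \<open>n > 0\<close>.\<close>

lemma mixed_Eulerian_polynomial:
  assumes "n > 0"
  obtains p q u where "simple_neg_zeros (k + n) u q" "reflects (k + n) p q"
    "\<And>i. i \<le> k + n \<Longrightarrow> 0 < (-1) ^ i * poly p (u i)"
    "fps_of_poly p =
       Abs_fps (\<lambda>m. (real m + 1) ^ Suc k * (2 * real m + 1) ^ n) * (1 - fps_X) ^ (k + n + 2)"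
proof -
  have "\<exists>p q u. simple_neg_zeros (k + n) u q \<and> reflects (k + n) p q \<and> coeff p 0 = 1 \<and>
    (\<forall>i\<le>k + n. 0 \<le> (-1) ^ i * poly p (u i)) \<and>
    (n > 0 \<longrightarrow> (\<forall>i\<le>k + n. 0 < (-1) ^ i * poly p (u i))) \<and>
    fps_of_poly p =
       Abs_fps (\<lambda>m. (real m + 1) ^ Suc k * (2 * real m + 1) ^ n) * (1 - fps_X) ^ (k + n + 2)"
  proof (induction n)
    case 0
    obtain p u where p: "simple_neg_zeros k u p" "reflects k p p" "coeff p 0 = 1"
      "fps_of_poly p = Abs_fps (\<lambda>m. (real m + 1) ^ Suc k) * (1 - fps_X) ^ (k + 2)"
      by (rule Eulerian_polynomial)
    have "0 \<le> (-1) ^ i * poly p (u i)" if "i \<le> k" for i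
    proof (cases i)
      case 0
      then show ?thesis using p(1,3) by (simp add: simple_neg_zeros_def poly_0_coeff_0)
    next
      case (Suc j)
      then have "poly p (u i) = 0"
        using p(1) that by (auto simp: simple_neg_zeros_def Suc intro!: bexI[of _ j])
      then show ?thesis by simp
    qed
    with p show ?case by (intro exI[of _ p] exI[of _ u]) simp
  next
    case (Suc n)
    define d where "d = k + n"
    obtain p q u where q: "simple_neg_zeros d u q" and refl: "reflects d p q"
      and p: "coeff p 0 = 1" "\<And>i. i \<le> d \<Longrightarrow> 0 \<le> (-1) ^ i * poly p (u i)"
      "fps_of_poly p =
       Abs_fps (\<lambda>m. (real m + 1) ^ Suc k * (2 * real m + 1) ^ n) * (1 - fps_X) ^ Suc (d + 1)"
      using Suc by (auto simp: d_def)
    \<comment> \<open>\<open>B = 2 * (d + 2) - 1\<close> comes from \<open>fps_eulerian_op\<close>;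
      reflection turns the parameters \<open>1\<close>, \<open>B\<close> into
      \<open>B - 2 * d = 1 + 2\<close> and \<open>1 + 2 * d = B - 2\<close>.\<close>
    define B where "B = 2 * real d + 3"
    obtain w where w: "simple_neg_zeros (Suc d) w (eulerian_op (1 + 2) (B - 2) 2 q)"
      "\<And>i. i \<le> d \<Longrightarrow> w (Suc i) < u i" "\<And>i. i < d \<Longrightarrow> u (Suc i) < w (Suc i)"
      using eulerian_op_zeros[OF q, of "1 + 2" 2 "B - 2"] by (auto simp: B_def)
    have "degree p \<le> d" using refl by (simp add: reflects_def)
    then have alt: "0 < (-1) ^ i * poly (eulerian_op 1 B 2 p) (w i)" if "i \<le> Suc d" for i
      using q w p that by (intro eulerian_op_interlacing) (auto simp: poly_0_coeff_0)
    have "reflects (Suc d) (eulerian_op 1 B 2 p) (eulerian_op (1 + 2) (B - 2) 2 q)"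
      using reflects_eulerian_op[OF refl, of 1 B 2] by (simp add: B_def add.commute)
    moreover have "fps_of_poly (eulerian_op 1 B 2 p) =
        Abs_fps (\<lambda>m. (real m + 1) ^ Suc k * (2 * real m + 1) ^ Suc n) * (1 - fps_X) ^ (Suc d + 2)"
      using fps_eulerian_op[OF p(3), of 1 2] by (simp add: B_def algebra_simps)
    moreover have "coeff (eulerian_op 1 B 2 p) 0 = 1"
      using p(1) by simp
    ultimately show ?case
      using w(1) alt alt[THEN less_imp_le] unfolding d_def add_Suc_right[symmetric]
      by (intro exI[of _ "eulerian_op 1 B 2 p"] exI[of _ "eulerian_op (1 + 2) (B - 2) 2 q"]
          exI[of _ w] conjI allI impI)
  qed
  then show thesis using that assms by blast
qed

theorem proposition5p6:
  fixes n S :: nat and s :: "nat \<Rightarrow> nat" and p :: "real poly"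
  assumes "n \<ge> 1"
    and "\<And>i. i \<in> {1..n} \<Longrightarrow> s i \<in> {1, 2}"
    and "S = (\<Sum>i=1..n. s i)"
    and "Abs_fps (\<lambda>m. (real m + 1) ^ (S - n) * (2 * real m + 1) ^ n) =
           fps_of_poly p / (1 - fps_X) ^ (S + 1)"
  shows "alternatingly_increasing p \<and>
    (n < S \<longrightarrow>
       inv_poly (S - 1) p \<lless> p \<and>
       (\<exists>!ab. inv_decomposition (S - 1) p ab) \<and>
       (\<forall>a b. inv_decomposition (S - 1) p (a, b) \<longrightarrow> b \<lless> a))"
proof -
  have "(\<Sum>i=1..n. 1) \<le> S"
    unfolding assms(3) using assms(2) by (intro sum_mono) fastforce
  then have "n \<le> S" by simp
  have fps: "fps_of_poly p =
      Abs_fps (\<lambda>m. (real m + 1) ^ (S - n) * (2 * real m + 1) ^ n) * (1 - fps_X) ^ Suc S"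
    unfolding assms(4) by (simp add: fps_divide_unit mult.assoc inverse_mult_eq_1 del: power_Suc)
  show ?thesis
  proof (cases "n = S")
    case True
    \<comment> \<open>Here \<open>p\<close> has degree \<open>n = S\<close>, above
      \<open>S - 1\<close>, and only the first claim remains: \<open>p\<close> is palindromic, so it
      follows from unimodality.\<close>
    obtain p' u where p': "simple_neg_zeros n u p'" "reflects n p' p'"
      "fps_of_poly p' = Abs_fps (\<lambda>m. (2 * real m + 1) ^ n) * (1 - fps_X) ^ Suc n"
      by (rule type_B_Eulerian_polynomial)
    have "p' = p"
      using fps p'(3) True by (simp flip: fps_of_poly_eq_iff)
    then have p: "simple_neg_zeros n u p" "reflects n p p" using p'(1,2) by simp_all
    have pal: "coeff p i = coeff p (n - i)" if "i \<le> n" for i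
      using p(2) that unfolding reflects_def by blast
    obtain C where C: "C > 0" "p = smult C (\<Prod>i<n. [:- u (Suc i), 1:])"
      using p(1) by (auto simp: simple_neg_zeros_def)
    have neg: "u (Suc i) \<le> 0" if "i < n" for i
      using p(1) that decreasing_uptoD[of n u 0 "Suc i"] by (simp add: simple_neg_zeros_def)
    have "coeff p i \<le> coeff p (Suc i)" if "2 * i + 1 \<le> n" for i
      using C neg that by (intro coeff_palindromic_mono[OF C(2) _ _ pal]) auto
    moreover have "coeff p (n - i) = coeff p i" if "i < n" for i
      using pal[of i] that by simp
    moreover have "0 \<le> coeff p 0"
      using C coeff_prod_linear_log_concave(1)[of n "\<lambda>i. u (Suc i)" 0] neg by simp
    ultimately have "alternatingly_increasing p"
      using simple_neg_zeros_degree(1)[OF p(1)]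
      by (auto simp: alternatingly_increasing_def Let_def)
    then show ?thesis using True by simp
  next
    case False
    \<comment> \<open>The exponent \<open>S - n\<close> of \<open>m + 1\<close> is
      \<open>Suc k\<close>, and \<open>S - 1 = k + n\<close> is the degree of
      \<open>p\<close>.\<close>
    define k where "k = S - n - 1"
    have k: "S - n = Suc k" "S - 1 = k + n" "Suc S = k + n + 2"
      using False \<open>n \<le> S\<close> by (auto simp: k_def)
    obtain p' q u where p': "simple_neg_zeros (k + n) u q" "reflects (k + n) p' q"
      "\<And>i. i \<le> k + n \<Longrightarrow> 0 < (-1) ^ i * poly p' (u i)"
      "fps_of_poly p' =
       Abs_fps (\<lambda>m. (real m + 1) ^ Suc k * (2 * real m + 1) ^ n) * (1 - fps_X) ^ (k + n + 2)"
      by (rule mixed_Eulerian_polynomial[of n k]) (use assms(1) in auto)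
    have "p' = p"
      using fps p'(4) unfolding k by (simp flip: fps_of_poly_eq_iff)
    then have p: "reflects (k + n) p q" "k + n \<ge> 1"
      "\<And>i. i \<le> k + n \<Longrightarrow> 0 < (-1) ^ i * poly p (u i)"
      using p'(2,3) assms(1) by simp_all
    show ?thesis
      unfolding k(2) using interlacing_symmetric_decomposition[OF p'(1) p]
        inv_decomposition_unique_exists[OF p(1,2)] by blast
  qed
qed

end
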